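(* Assume that the multicharge $\kappa\in(\mathbb{Z}/e\mathbb{Z})^r$ is compatible with $(d,\eta,p)$. Let $\lambda$ be an $r$-partition and let $\alpha := \alpha_\kappa(\lambda)$. Then there exists an $r$-partition $\mu$ with $\alpha_\kappa(\mu) = \alpha$ and $\#[\mu] = \#[\alpha]$.
   Context: Let $d,\eta,p\geq 1$ be integers, put $e := \eta p$ (assumed $\geq 2$) and $r := dp$. Identify $\mathbb{Z}/e\mathbb{Z}$ with $\{0,\dots,e-1\}$ and $\mathbb{Z}/r\mathbb{Z}$ with $\{0,\dots,r-1\}$. A multicharge $\kappa=(\kappa_0,\dots,\kappa_{r-1})\in(\mathbb{Z}/e\mathbb{Z})^r$ is compatible with $(d,\eta,p)$ if $\kappa_{k+d}=\kappa_k+\eta$ for all $k\in\mathbb{Z}/r\mathbb{Z}$. A partition is a finite non-increasing sequence of positive integers $\lambda=(\lambda_0,\dots,\lambda_{h-1})$; its Young diagram is $\mathcal{Y}(\lambda)=\{(a,b)\in\mathbb{N}^2 : 0\le a\le h-1,\ 0\le b\le\lambda_a-1\}$. An $r$-partition is an $r$-tuple $\lambda=(\lambda^{(0)},\dots,\lambda^{(r-1)})$ of partitions; its Young diagram is $\mathcal{Y}(\lambda)=\bigcup_{c=0}^{r-1}\mathcal{Y}(\lambda^{(c)})\times\{c\}$. The $\kappa$-residue of a node $(a,b,c)$ is $\mathrm{res}_\kappa(a,b,c)=b-a+\kappa_c\in\mathbb{Z}/e\mathbb{Z}$. Let $Q=\bigoplus_{i\in\mathbb{Z}/e\mathbb{Z}}\mathbb{Z}\alpha_i$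 be a free $\mathbb{Z}$-module with basis $(\alpha_i)_{i\in\mathbb{Z}/e\mathbb{Z}}$ and $Q^+=\bigoplus_i\mathbb{N}\alpha_i$. For an $r$-partition $\lambda$ put $\alpha_\kappa(\lambda)=\sum_{\gamma\in\mathcal{Y}(\lambda)}\alpha_{\mathrm{res}_\kappa(\gamma)}\in Q^+$. Shifts: on $Q$, $\sigma$ is the $\mathbb{Z}$-linear map with $\sigma\cdot\alpha_i=\alpha_{i+\eta}$; on $r$-partitions, ${}^{\sigma}\lambda=(\lambda^{(r-d)},\dots,\lambda^{(r-1)},\lambda^{(0)},\dots,\lambda^{(r-d-1)})$. The symbols $[\lambda]$ and $[\alpha]$ denote the orbits of $\lambda$ and $\alpha$ under the corresponding action of $\sigma$. *)

theory Defs
  imports "HOL-Library.Poly_Mapping" "HOL-Combinatorics.Orbits"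
begin

text \<open>
  Elements of \<open>\<int>/e\<int>\<close> are represented by their canonical representatives in
  \<open>{0..<int e}\<close>, so equality in \<open>\<int>/e\<int>\<close> is equality of integers.
\<close>

definition multicharge :: "nat \<Rightarrow> nat \<Rightarrow> int list \<Rightarrow> bool" where
  "multicharge e r \<kappa> \<longleftrightarrow> length \<kappa> = r \<and> set \<kappa> \<subseteq> {0..<int e}"

definition compatible :: "nat \<Rightarrow> nat \<Rightarrow> nat \<Rightarrow> int list \<Rightarrow> bool" where
  "compatible d \<eta> p \<kappa> \<longleftrightarrow>
     (\<forall>k < d * p. \<kappa> ! ((k + d) mod (d * p)) = (\<kappa> ! k + int \<eta>) mod int (\<eta> * p))"

definition is_partition :: "nat list \<Rightarrow> bool" where
  "is_partition l \<longleftrightarrow> sorted_wrt (\<ge>) l \<and> 0 \<notin> set l"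

definition young_diagram :: "nat list \<Rightarrow> (nat \<times> nat) set" where
  "young_diagram l = {(a, b). a < length l \<and> b < l ! a}"

definition multipartition :: "nat \<Rightarrow> nat list list \<Rightarrow> bool" where
  "multipartition r \<Lambda> \<longleftrightarrow> length \<Lambda> = r \<and> (\<forall>l \<in> set \<Lambda>. is_partition l)"

definition multi_young_diagram :: "nat list list \<Rightarrow> (nat \<times> nat \<times> nat) set" where
  "multi_young_diagram \<Lambda> =
     (\<Union>c < length \<Lambda>. {(a, b, c) | a b. (a, b) \<in> young_diagram (\<Lambda> ! c)})"

fun residue :: "nat \<Rightarrow> int list \<Rightarrow> nat \<times> nat \<times> nat \<Rightarrow> int" where
  "residue e \<kappa> (a, b, c) = (int b - int a + \<kappa> ! c) mod int e"

text \<open>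
  The free \<open>\<int>\<close>-module \<open>Q\<close> consists of the formal integer combinations of type
  \<^typ>\<open>int \<Rightarrow>\<^sub>0 int\<close> supported on \<open>{0..<int e}\<close>, with basis \<open>\<alpha>\<^sub>i = frag_of i\<close>.
\<close>

definition alpha :: "nat \<Rightarrow> int list \<Rightarrow> nat list list \<Rightarrow> int \<Rightarrow>\<^sub>0 int" where
  "alpha e \<kappa> \<Lambda> = (\<Sum>\<gamma> \<in> multi_young_diagram \<Lambda>. frag_of (residue e \<kappa> \<gamma>))"

definition shift_Q :: "nat \<Rightarrow> nat \<Rightarrow> (int \<Rightarrow>\<^sub>0 int) \<Rightarrow> (int \<Rightarrow>\<^sub>0 int)" where
  "shift_Q e \<eta> = frag_extend (\<lambda>i. frag_of ((i + int \<eta>) mod int e))"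

definition shift_mp :: "nat \<Rightarrow> nat list list \<Rightarrow> nat list list" where
  "shift_mp d \<Lambda> = drop (length \<Lambda> - d) \<Lambda> @ take (length \<Lambda> - d) \<Lambda>"

text \<open>
  Orbits are taken with \<^const>\<open>orbit\<close>, i.e. as sets of positive iterates.  The following
  facts show that both shifts have order dividing \<open>p\<close>, so that these are the orbits of the
  cyclic group generated by the shift.
\<close>

lemma finite_multi_young_diagram: "finite (multi_young_diagram \<Lambda>)"
proof -
  have "finite (young_diagram l)" for l
  proof -
    have "young_diagram l = (SIGMA a:{..<length l}. {..<l ! a})"
      by (auto simp: young_diagram_def)
    then show ?thesis by simp
  qed
  moreover have "{(a, b, c) | a b. (a, b) \<in> young_diagram (\<Lambda> ! c)}
      = (\<lambda>(a, b). (a, b, c)) ` young_diagram (\<Lambda> ! c)" for c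
    by auto
  ultimately show ?thesis
    unfolding multi_young_diagram_def by auto
qed

lemma keys_alpha:
  assumes "e > 0"
  shows "Poly_Mapping.keys (alpha e \<kappa> \<Lambda>) \<subseteq> {0..<int e}"
proof -
  have "residue e \<kappa> \<gamma> \<in> {0..<int e}" for \<gamma>
    using assms by (cases \<gamma>) auto
  then have "(\<Union>\<gamma> \<in> multi_young_diagram \<Lambda>. Poly_Mapping.keys (frag_of (residue e \<kappa> \<gamma>)))
      \<subseteq> {0..<int e}"
    by auto
  then show ?thesis
    unfolding alpha_def by (rule order_trans[OF keys_sum])
qed

lemma shift_mp_funpow:
  assumes "length \<Lambda> = d * p"
  shows "(shift_mp d ^^ p) \<Lambda> = \<Lambda>"
proof (cases "p = 0")
  case False
  let ?m = "d * p - d"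
  have "(shift_mp d ^^ n) \<Lambda> = rotate (n * ?m) \<Lambda>" for n
  proof (induction n)
    case (Suc n)
    have "shift_mp d xs = rotate ?m xs" if "length xs = d * p" for xs
    proof (cases "d = 0")
      case True
      with that show ?thesis by (simp add: shift_mp_def)
    next
      case False
      with \<open>p \<noteq> 0\<close> that have "?m < length xs" by simp
      then show ?thesis using that by (simp add: shift_mp_def rotate_drop_take)
    qed
    then show ?case using Suc assms by (simp add: rotate_rotate)
  qed simp
  moreover have "p * ?m mod length \<Lambda> = 0"
    using assms by (metis diff_mult_distrib2 mod_mult_self1_is_0 mult.commute mult.left_commute mult.right_neutral)
  ultimately show ?thesis by (metis rotate_id)
qed simp

lemma shift_Q_funpow:
  assumes "Poly_Mapping.keys x \<subseteq> {0..<int (\<eta> * p)}"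
  shows "(shift_Q (\<eta> * p) \<eta> ^^ p) x = x"
proof -
  let ?e = "int (\<eta> * p)"
  have "(shift_Q (\<eta> * p) \<eta> ^^ n) x = frag_extend (\<lambda>i. frag_of ((i + int (n * \<eta>)) mod ?e)) x" for n
  proof (induction n)
    case 0
    have "frag_extend (\<lambda>i. frag_of (i mod ?e)) x = frag_extend frag_of x"
      using assms by (intro frag_extend_eq) auto
    then show ?case by (simp flip: frag_expansion)
  next
    case (Suc n)
    have "((i + int (n * \<eta>)) mod ?e + int \<eta>) mod ?e = (i + int (Suc n * \<eta>)) mod ?e" for i
      unfolding mod_add_left_eq by (simp add: ac_simps)
    with Suc show ?case
      by (simp add: shift_Q_def frag_extend_compose[unfolded o_def] del: of_nat_mult)
  qed
  also have "frag_extend (\<lambda>i. frag_of ((i + int (p * \<eta>)) mod ?e)) x = frag_extend frag_of x"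
    using assms by (intro frag_extend_eq) (auto simp: mult.commute)
  finally show ?thesis by (simp flip: frag_expansion)
qed

lemma self_in_orbit_shift_mp:
  assumes "length \<Lambda> = d * p" "p \<ge> 1"
  shows "\<Lambda> \<in> orbit (shift_mp d) \<Lambda>"
  unfolding orbit_altdef using shift_mp_funpow[OF assms(1)] assms(2)
  by (intro CollectI exI[of _ p]) simp

lemma self_in_orbit_shift_Q:
  assumes "Poly_Mapping.keys x \<subseteq> {0..<int (\<eta> * p)}" "p \<ge> 1"
  shows "x \<in> orbit (shift_Q (\<eta> * p) \<eta>) x"
  unfolding orbit_altdef using shift_Q_funpow[OF assms(1)] assms(2)
  by (intro CollectI exI[of _ p]) simp

end

theory Submission
  imports Defs "HOL-Number_Theory.Cong"
begin

text \<open>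
  Let \<open>t\<close> be the size of the orbit of \<open>\<alpha>\<close> and \<open>p = t * q\<close>.  The map \<open>alpha\<close> intertwines the two shifts,
  so the orbit of any \<open>\<mu>\<close> with \<open>alpha e \<kappa> \<mu> = \<alpha>\<close> has at least \<open>t\<close> elements, and it suffices to find
  such a \<open>\<mu>\<close> that is fixed by \<open>t\<close> shifts, that is, one consisting of \<open>q\<close> copies of a
  \<open>(d * t)\<close>-partition \<open>\<nu>\<close>.  By compatibility, the \<open>q\<close> copies of a node have residues
  that differ by the multiples of \<open>h = \<eta> * t\<close>, so the condition on \<open>\<nu>\<close> is that for every \<open>i\<close> it
  has as many nodes of residue \<open>i\<close> modulo \<open>h\<close> as \<open>\<Lambda>\<close> has of residue \<open>i\<close> modulo \<open>e\<close>; this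
  number \<open>f i\<close> depends only on \<open>i\<close> modulo \<open>h\<close>, because \<open>\<alpha>\<close> is invariant under \<open>t\<close> shifts.
  Hence the theorem becomes a folding statement, \<open>folded_counts_realised\<close>: a vector \<open>f\<close> realised
  upstairs (modulo \<open>e\<close>, with \<open>r\<close> components) and periodic modulo \<open>h\<close> is realised downstairs
  (modulo \<open>h\<close>, with \<open>d * t\<close> components).

  The proof of the folding statement follows the description of the weights of an integrable
  highest weight module of an affine Lie algebra as the Weyl group images of the dominant weights
  below the highest one, in elementary form.  The basic identity \<open>addable_removable_balance\<close>
  expresses the number of addable minus the number of removable nodes of residue \<open>i\<close> as
  \<open>m i - 2 * f i + f (i - 1) + f (i + 1)\<close>, where \<open>m i\<close> counts the components of charge \<open>i\<close>.
  For a periodic \<open>f\<close> this quantity is the same upstairs and downstairs.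

  If it is nonnegative for all \<open>i\<close>, then \<open>f\<close> is realised downstairs by a maximum principle
  (\<open>dominant_counts_realised\<close>).  If it equals \<open>-n < 0\<close> for some \<open>i\<close>, then upstairs there are \<open>n\<close>
  removable nodes for every residue above \<open>i\<close>.  Deleting them yields a smaller realised
  periodic vector, which is realised downstairs by induction; there the quantity at \<open>i\<close> has
  become \<open>n\<close>, so \<open>n\<close> addable nodes of residue \<open>i\<close> exist, and inserting them restores \<open>f\<close>.
\<close>

section \<open>Diagrams and residue counts\<close>

type_synonym node = "nat \<times> nat \<times> nat"

text \<open>
  Working with sets of nodes instead of tuples of partitions makes it possible to remove or add
  several nodes at once without bookkeeping on row lengths.  The Young diagrams of
  \<open>r\<close>-partitions are exactly the finite sets of nodes with component below \<open>r\<close> that are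
  closed under moving up and to the left.
\<close>

definition diagram :: "nat \<Rightarrow> node set \<Rightarrow> bool" where
  "diagram r D \<longleftrightarrow> finite D \<and> D \<subseteq> UNIV \<times> UNIV \<times> {..<r} \<and>
     (\<forall>a b c. (Suc a, b, c) \<in> D \<longrightarrow> (a, b, c) \<in> D) \<and>
     (\<forall>a b c. (a, Suc b, c) \<in> D \<longrightarrow> (a, b, c) \<in> D)"

definition addable :: "nat \<Rightarrow> node set \<Rightarrow> node set" where
  "addable r D = {(a, b, c). c < r \<and> (a, b, c) \<notin> D \<and>
     (a = 0 \<or> (a - 1, b, c) \<in> D) \<and> (b = 0 \<or> (a, b - 1, c) \<in> D)}"

definition removable :: "node set \<Rightarrow> node set" where
  "removable D = {(a, b, c). (a, b, c) \<in> D \<and> (Suc a, b, c) \<notin> D \<and> (a, Suc b, c) \<notin> D}"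

definition corners :: "nat \<Rightarrow> node set" where
  "corners r = {(0, 0, c) | c. c < r}"

fun content :: "(nat \<Rightarrow> int) \<Rightarrow> node \<Rightarrow> int" where
  "content K (a, b, c) = int b - int a + K c"

text \<open>
  The charge \<open>K\<close> is integer-valued and the residue is an arbitrary integer, compared modulo
  \<open>e\<close>.  This way one charge serves several moduli, and residues can be
  incremented without reduction.
\<close>

definition nodes_at :: "int \<Rightarrow> (nat \<Rightarrow> int) \<Rightarrow> node set \<Rightarrow> int \<Rightarrow> node set" where
  "nodes_at e K D i = {x \<in> D. [content K x = i] (mod e)}"

abbreviation count_at :: "int \<Rightarrow> (nat \<Rightarrow> int) \<Rightarrow> node set \<Rightarrow> int \<Rightarrow> nat" where
  "count_at e K D i \<equiv> card (nodes_at e K D i)"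

lemma finite_nodes_at [simp]: "finite D \<Longrightarrow> finite (nodes_at e K D i)"
  by (simp add: nodes_at_def)

lemma nodes_at_cong: "[i = j] (mod e) \<Longrightarrow> nodes_at e K D i = nodes_at e K D j"
  unfolding nodes_at_def using cong_trans cong_sym by blast

lemma nodes_at_mod [simp]: "nodes_at e K D (i mod e) = nodes_at e K D i"
  by (rule nodes_at_cong) simp

lemma finite_corners [simp]: "finite (corners r)"
  by (simp add: corners_def)

lemma finite_addable:
  assumes "finite D"
  shows "finite (addable r D)"
proof (rule finite_subset)
  show "addable r D \<subseteq> corners r \<union> (\<lambda>(a, b, c). (Suc a, b, c)) ` D \<union> (\<lambda>(a, b, c). (a, Suc b, c)) ` D"
  proof
    fix x assume "x \<in> addable r D"
    then obtain a b c where x: "x = (a, b, c)" "c < r" "a = 0 \<or> (a - 1, b, c) \<in> D"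
        "b = 0 \<or> (a, b - 1, c) \<in> D"
      by (auto simp: addable_def)
    then show "x \<in> corners r \<union> (\<lambda>(a, b, c). (Suc a, b, c)) ` D \<union> (\<lambda>(a, b, c). (a, Suc b, c)) ` D"
      by (cases a; cases b) (force simp: corners_def)+
  qed
qed (use assms in auto)

lemma finite_removable: "finite D \<Longrightarrow> finite (removable D)"
  by (rule finite_subset[of _ D]) (auto simp: removable_def)

lemma diagram_empty: "diagram r {}"
  by (simp add: diagram_def)

lemma diagram_finite: "diagram r D \<Longrightarrow> finite D"
  by (simp add: diagram_def)

text \<open>
  Two removable nodes never depend on each other, and neither do two addable ones: arbitrary sets of
  removable nodes can be deleted, and arbitrary sets of addable nodes inserted, in a single step.
\<close>

lemma diagram_diff_removable:
  assumes "diagram r D" "T \<subseteq> removable D"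
  shows "diagram r (D - T)"
  using assms unfolding diagram_def removable_def by (intro conjI) (blast+)

lemma diagram_union_addable:
  assumes "diagram r D" "T \<subseteq> addable r D"
  shows "diagram r (D \<union> T)"
proof -
  have fin: "finite (D \<union> T)"
    using assms finite_subset[OF assms(2) finite_addable] by (simp add: diagram_def)
  have T: "c < r \<and> (a, b, c) \<notin> D \<and> (a = 0 \<or> (a - 1, b, c) \<in> D) \<and> (b = 0 \<or> (a, b - 1, c) \<in> D)"
    if "(a, b, c) \<in> T" for a b c
    using that assms(2) by (auto simp: addable_def)
  have closed: "(a, b, c) \<in> D" if "(Suc a, b, c) \<in> D \<or> (a, Suc b, c) \<in> D" for a b c
    using that assms(1) unfolding diagram_def by blast
  have 1: "(a, b, c) \<in> D \<union> T" if "(Suc a, b, c) \<in> D \<union> T" for a b c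
    using that T[of "Suc a" b c] closed[of a b c] by (metis Un_iff diff_Suc_1 nat.distinct(1))
  have 2: "(a, b, c) \<in> D \<union> T" if "(a, Suc b, c) \<in> D \<union> T" for a b c
    using that T[of a "Suc b" c] closed[of a b c] by (metis Un_iff diff_Suc_1 nat.distinct(1))
  have 3: "D \<union> T \<subseteq> UNIV \<times> UNIV \<times> {..<r}"
  proof (rule Un_least)
    show "D \<subseteq> UNIV \<times> UNIV \<times> {..<r}" using assms(1) unfolding diagram_def by blast
    show "T \<subseteq> UNIV \<times> UNIV \<times> {..<r}" using T by auto
  qed
  show ?thesis
    unfolding diagram_def using fin 1 2 3 by blast
qed

lemma count_at_diff:
  assumes "finite D" "T \<subseteq> D"
  shows "count_at e K (D - T) i + count_at e K T i = count_at e K D i"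
proof -
  have "nodes_at e K D i = nodes_at e K (D - T) i \<union> nodes_at e K T i"
    using assms(2) by (auto simp: nodes_at_def)
  moreover have "nodes_at e K (D - T) i \<inter> nodes_at e K T i = {}"
    by (auto simp: nodes_at_def)
  ultimately show ?thesis
    using assms by (simp add: card_Un_disjoint finite_subset)
qed

lemma count_at_union:
  assumes "finite D" "finite T" "D \<inter> T = {}"
  shows "count_at e K (D \<union> T) i = count_at e K D i + count_at e K T i"
proof -
  have "(D \<union> T) - T = D" using assms(3) by auto
  then show ?thesis using count_at_diff[of "D \<union> T" T e K i] assms by simp
qed

lemma card_eq_sum_count_at:
  assumes "finite D" "e > 0"
  shows "card D = (\<Sum>i = 0..<e. count_at e K D i)"
proof -
  have D: "D = (\<Union>i\<in>{0..<e}. nodes_at e K D i)"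
  proof (intro equalityI subsetI)
    fix x assume "x \<in> D"
    then have "x \<in> nodes_at e K D (content K x mod e)" by (simp add: nodes_at_def)
    moreover have "content K x mod e \<in> {0..<e}" using assms(2) by simp
    ultimately show "x \<in> (\<Union>i\<in>{0..<e}. nodes_at e K D i)" by (rule UN_I[rotated])
  qed (auto simp: nodes_at_def)
  have "card (\<Union>i\<in>{0..<e}. nodes_at e K D i) = (\<Sum>i = 0..<e. count_at e K D i)"
  proof (rule card_UN_disjoint)
    show "\<forall>i\<in>{0..<e}. \<forall>j\<in>{0..<e}. i \<noteq> j \<longrightarrow> nodes_at e K D i \<inter> nodes_at e K D j = {}"
      by (auto simp: nodes_at_def cong_def)
  qed (use assms in auto)
  with D show ?thesis by simp
qed

text \<open>
  The first free node in the top row of the component \<open>0\<close> is addable.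
\<close>

lemma addable_exists:
  assumes "finite D" "0 < r"
  shows "addable r D \<noteq> {}"
proof -
  have "finite ((\<lambda>b. (0 :: nat, b, 0 :: nat)) -` D)"
    using assms(1) by (rule finite_vimageI) (auto simp: inj_def)
  then have ex: "\<exists>b. (0, b, 0) \<notin> D"
    using infinite_UNIV_nat by (metis (mono_tags) UNIV_eq_I vimageI2)
  define b where "b = (LEAST b. (0, b, 0) \<notin> D)"
  have "(0, b, 0) \<notin> D" unfolding b_def using ex by (rule LeastI_ex)
  moreover have "b = 0 \<or> (0, b - 1, 0) \<in> D"
    using not_less_Least[of "b - 1" "\<lambda>b. (0, b, 0) \<notin> D"] by (cases b) (auto simp: b_def)
  ultimately show ?thesis using assms(2) by (auto simp: addable_def)
qed

section \<open>The balance of addable and removable nodes\<close>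

text \<open>
  The number of addable \<open>i\<close>-nodes minus the number of removable ones is the pairing of the weight
  with the \<open>i\<close>-th simple coroot, so it depends only on the residue counts of the diagram.

  Extend the indicator function of \<open>D\<close> by zero to negative coordinates and, at every node
  \<open>(a, b, c)\<close>, take its mixed second difference over the square with corners
  \<open>(a, b)\<close>, \<open>(a - 1, b)\<close>, \<open>(a, b - 1)\<close>, \<open>(a - 1, b - 1)\<close>.  As \<open>D\<close> is closed under moving up and left, that
  difference is \<open>-1\<close> at an addable node, \<open>1\<close> one diagonal step after a removable node, and zero
  elsewhere, except that each corner of the quadrant contributes an extra \<open>1\<close>.
  Summing over all nodes of residue \<open>i\<close> gives the identity: the two diagonal terms both
  count nodes of residue \<open>i\<close>, the other two count nodes of residues \<open>i + 1\<close> and \<open>i - 1\<close>.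
\<close>

lemma addable_removable_balance:
  assumes "diagram r D"
  shows "count_at e K (addable r D) i + 2 * count_at e K D i =
    count_at e K (removable D) i + count_at e K (corners r) i
      + count_at e K D (i - 1) + count_at e K D (i + 1)"
proof -
  define down :: "node \<Rightarrow> node" where "down = (\<lambda>(a, b, c). (Suc a, b, c))"
  define right :: "node \<Rightarrow> node" where "right = (\<lambda>(a, b, c). (a, Suc b, c))"
  define diag :: "node \<Rightarrow> node" where "diag = (\<lambda>(a, b, c). (Suc a, Suc b, c))"
  note dfs = down_def right_def diag_def
  have inj: "inj down" "inj right" "inj diag"
    by (auto simp: inj_def dfs)
  have fin: "finite D" and lt: "\<And>a b c. (a, b, c) \<in> D \<Longrightarrow> c < r"
    and low1: "\<And>a b c. (Suc a, b, c) \<in> D \<Longrightarrow> (a, b, c) \<in> D"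
    and low2: "\<And>a b c. (a, Suc b, c) \<in> D \<Longrightarrow> (a, b, c) \<in> D"
    using assms unfolding diagram_def by blast+
  have S: "[content K (Suc a, b, c) = i] (mod e) \<longleftrightarrow> [content K (a, b, c) = i + 1] (mod e)"
      "[content K (a, Suc b, c) = i] (mod e) \<longleftrightarrow> [content K (a, b, c) = i - 1] (mod e)"
      "[content K (Suc a, Suc b, c) = i] (mod e) \<longleftrightarrow> [content K (a, b, c) = i] (mod e)" for a b c i
    by (auto simp: cong_iff_dvd_diff algebra_simps)
  \<comment> \<open>Each term of the identity is the size of a set of nodes of residue \<open>i\<close>; values of the
    indicator function at neighbouring nodes become memberships in translates of \<open>D\<close>.\<close>
  define A B L R U O' where "A = nodes_at e K (addable r D) i" "B = diag ` nodes_at e K D i"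
    "L = right ` nodes_at e K D (i - 1)" "R = diag ` nodes_at e K (removable D) i"
    "U = down ` nodes_at e K D (i + 1)" "O' = nodes_at e K (corners r) i"
  note sets = this
  define X where "X = A \<union> nodes_at e K D i \<union> B \<union> L \<union> R \<union> U \<union> O'"
  have finX: "finite X"
    unfolding X_def sets using fin by (simp add: finite_addable finite_removable)
  have pt: "of_bool (x \<in> A) + of_bool (x \<in> nodes_at e K D i) + of_bool (x \<in> B)
      = (of_bool (x \<in> R) + of_bool (x \<in> O') + of_bool (x \<in> L) + of_bool (x \<in> U) :: nat)" for x
  proof -
    obtain a b c where x: "x = (a, b, c)" by (cases x)
    have img: "(Suc a, b, c) \<in> down ` N \<longleftrightarrow> (a, b, c) \<in> N" "(0, b, c) \<notin> down ` N"
        "(a, Suc b, c) \<in> right ` N \<longleftrightarrow> (a, b, c) \<in> N" "(a, 0, c) \<notin> right ` N"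
        "(Suc a, Suc b, c) \<in> diag ` N \<longleftrightarrow> (a, b, c) \<in> N" "(0, b, c) \<notin> diag ` N"
        "(a, 0, c) \<notin> diag ` N" for a b c N
      by (force simp: dfs)+
    let ?t = "[content K (a, b, c) = i] (mod e)"
    have mem: "x \<in> A \<longleftrightarrow> x \<in> addable r D \<and> ?t" "x \<in> nodes_at e K D i \<longleftrightarrow> x \<in> D \<and> ?t"
        "x \<in> O' \<longleftrightarrow> x \<in> corners r \<and> ?t"
      by (simp_all add: sets nodes_at_def x del: content.simps)
    have memB: "x \<in> B \<longleftrightarrow> a > 0 \<and> b > 0 \<and> (a - 1, b - 1, c) \<in> D \<and> ?t"
      unfolding sets x by (cases a; cases b) (simp_all add: img nodes_at_def S del: content.simps)
    have memR: "x \<in> R \<longleftrightarrow> a > 0 \<and> b > 0 \<and> (a - 1, b - 1, c) \<in> removable D \<and> ?t"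
      unfolding sets x by (cases a; cases b) (simp_all add: img nodes_at_def S del: content.simps)
    have memL: "x \<in> L \<longleftrightarrow> b > 0 \<and> (a, b - 1, c) \<in> D \<and> ?t"
      unfolding sets x by (cases a; cases b) (simp_all add: img nodes_at_def S del: content.simps)
    have memU: "x \<in> U \<longleftrightarrow> a > 0 \<and> (a - 1, b, c) \<in> D \<and> ?t"
      unfolding sets x by (cases a; cases b) (simp_all add: img nodes_at_def S del: content.simps)
    have core: "of_bool (x \<in> addable r D) + of_bool (x \<in> D) + of_bool (a > 0 \<and> b > 0 \<and> (a - 1, b - 1, c) \<in> D)
      = (of_bool (a > 0 \<and> b > 0 \<and> (a - 1, b - 1, c) \<in> removable D) + of_bool (x \<in> corners r)
         + of_bool (b > 0 \<and> (a, b - 1, c) \<in> D) + of_bool (a > 0 \<and> (a - 1, b, c) \<in> D) :: nat)"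
    proof (cases a; cases b)
      fix m n assume ab: "a = Suc m" "b = Suc n"
      show ?thesis
        using low1[of m "Suc n" c] low2[of "Suc m" n c] low1[of m n c] low2[of m n c] lt[of m n c]
        unfolding x ab addable_def removable_def corners_def
        by (cases "(m, n, c) \<in> D"; cases "(Suc m, n, c) \<in> D"; cases "(m, Suc n, c) \<in> D";
            cases "(Suc m, Suc n, c) \<in> D"; simp)
    next
      fix m assume ab: "a = Suc m" "b = 0"
      show ?thesis
        using low1[of m 0 c] lt[of m 0 c] unfolding x ab addable_def removable_def corners_def
        by (cases "(m, 0, c) \<in> D"; cases "(Suc m, 0, c) \<in> D"; simp)
    next
      fix n assume ab: "a = 0" "b = Suc n"
      show ?thesis
        using low2[of 0 n c] lt[of 0 n c] unfolding x ab addable_def removable_def corners_def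
        by (cases "(0, n, c) \<in> D"; cases "(0, Suc n, c) \<in> D"; simp)
    next
      assume ab: "a = 0" "b = 0"
      show ?thesis
        using lt[of 0 0 c] unfolding x ab addable_def removable_def corners_def
        by (cases "(0, 0, c) \<in> D"; simp)
    qed
    show ?thesis
    proof (cases ?t)
      case True
      with core show ?thesis unfolding mem memB memR memL memU by simp
    next
      case False
      then show ?thesis unfolding mem memB memR memL memU by simp
    qed
  qed
  have card: "card N = (\<Sum>x\<in>X. of_bool (x \<in> N))" if "N \<subseteq> X" for N
    using finX that by (simp add: sum.If_cases of_bool_def Int_absorb1)
  have sub: "A \<subseteq> X" "nodes_at e K D i \<subseteq> X" "B \<subseteq> X" "L \<subseteq> X" "R \<subseteq> X" "U \<subseteq> X" "O' \<subseteq> X"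
    by (auto simp: X_def)
  have "card A + count_at e K D i + card B = card R + card O' + card L + card U"
    unfolding sub[THEN card] sum.distrib[symmetric] pt ..
  moreover have "card B = count_at e K D i" "card R = count_at e K (removable D) i"
      "card L = count_at e K D (i - 1)" "card U = count_at e K D (i + 1)"
    unfolding sets by (rule card_image, rule inj_on_subset[OF _ subset_UNIV], rule inj)+
  ultimately show ?thesis by (simp add: sets)
qed

section \<open>Dominant vectors of residue counts\<close>

text \<open>
  The hypothesis \<open>dom\<close> says that the weight with residue counts \<open>f\<close> is dominant.  Take a diagram
  \<open>D\<close> with counts at most \<open>f\<close> and as many nodes as possible, and let \<open>g\<close> be the deficit.
  Where \<open>g\<close> is positive, maximality forbids an addable node of that residue, so the balance of
  addable and removable nodes together with dominance gives convexity of \<open>g\<close> there.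
  If \<open>g\<close> were nonzero, its maximum would by convexity propagate around the whole cycle of residues;
  then no node at all could be added to \<open>D\<close>, which is absurd.
\<close>

lemma dominant_counts_realised:
  fixes f :: "int \<Rightarrow> nat" and e :: int
  assumes "e > 0" "0 < r"
    and per: "\<And>i. f (i mod e) = f i"
    and dom: "\<And>i. 2 * f i \<le> count_at e K (corners r) i + f (i - 1) + f (i + 1)"
  shows "\<exists>D. diagram r D \<and> (\<forall>i. count_at e K D i = f i)"
proof -
  define P where "P D \<longleftrightarrow> diagram r D \<and> (\<forall>i. count_at e K D i \<le> f i)" for D
  have "P {}" by (simp add: P_def diagram_empty nodes_at_def)
  moreover have "card D < Suc (\<Sum>i = 0..<e. f i)" if "P D" for D
    using that card_eq_sum_count_at[of D e K] \<open>e > 0\<close>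
    by (auto simp: P_def diagram_finite less_Suc_eq_le intro!: sum_mono)
  ultimately obtain D where "P D" and max: "\<And>E. P E \<Longrightarrow> card E \<le> card D"
    using ex_has_greatest_nat[of P "{}" card] by blast
  then have D: "diagram r D" and le: "\<And>i. count_at e K D i \<le> f i" by (auto simp: P_def)
  define g where "g i = int (f i) - int (count_at e K D i)" for i
  have g_mod: "g (i mod e) = g i" for i
    by (simp add: g_def per)
  have no_add: "nodes_at e K (addable r D) i = {}" if "g i > 0" for i
  proof (rule ccontr)
    assume "nodes_at e K (addable r D) i \<noteq> {}"
    then obtain x where x: "x \<in> addable r D" "[content K x = i] (mod e)"
      by (auto simp: nodes_at_def)
    then have notin: "x \<notin> D" by (auto simp: addable_def)
    have "count_at e K (D \<union> {x}) j \<le> f j" for j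
    proof (cases "[content K x = j] (mod e)")
      case True
      then have "g j > 0"
        using that x(2) nodes_at_cong[of i j e K D] per[of i] per[of j]
        by (metis cong_def g_mod)
      then have "count_at e K D j < f j" by (simp add: g_def)
      moreover have "nodes_at e K {x} j = {x}" using True by (auto simp: nodes_at_def)
      ultimately show ?thesis
        using D notin by (subst count_at_union) (auto simp: diagram_finite)
    next
      case False
      then have "nodes_at e K {x} j = {}" by (auto simp: nodes_at_def)
      then show ?thesis
        using D notin le[of j] by (subst count_at_union) (auto simp: diagram_finite)
    qed
    then have "P (D \<union> {x})"
      using diagram_union_addable[OF D, of "{x}"] x by (simp add: P_def)
    then show False using max[of "D \<union> {x}"] notin D by (simp add: diagram_finite)
  qed
  have convex: "2 * g i \<le> g (i - 1) + g (i + 1)" if "g i > 0" for i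
    using addable_removable_balance[OF D, of e K i] no_add[OF that] dom[of i]
    by (simp add: g_def)
  have "g i = 0" for i
  proof (rule ccontr)
    assume "g i \<noteq> 0"
    then have pos: "g i > 0" using le[of i] by (simp add: g_def)
    define M where "M = Max (g ` {0..<e})"
    have fin: "finite (g ` {0..<e})" by simp
    have gM: "g j \<le> M" for j
      using fin \<open>e > 0\<close> g_mod[of j] unfolding M_def by (intro Max_ge) (auto intro!: image_eqI[of _ _ "j mod e"])
    have "M \<in> g ` {0..<e}" unfolding M_def using fin \<open>e > 0\<close> by (intro Max_in) auto
    then obtain j0 where j0: "g j0 = M" by auto
    have M: "M > 0" using pos gM[of i] by simp
    \<comment> \<open>Where \<open>g\<close> attains its maximum, convexity forces both neighbours to attain it as well.\<close>
    have "g (j0 + int n) = M" for n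
    proof (induction n)
      case (Suc n)
      then show ?case
        using convex[of "j0 + int n"] gM[of "j0 + int n - 1"] gM[of "j0 + int n + 1"] M
        by (simp add: ac_simps)
    qed (simp add: j0)
    from this[of "nat ((j - j0) mod e)" for j] have all: "g j = M" for j
      using g_mod[of j] g_mod[of "j0 + (j - j0) mod e"] \<open>e > 0\<close>
      by (simp add: mod_add_right_eq)
    obtain x where "x \<in> addable r D"
      using addable_exists[of D r] D \<open>0 < r\<close> by (auto simp: diagram_finite)
    then have "x \<in> nodes_at e K (addable r D) (content K x)" by (simp add: nodes_at_def)
    with no_add[of "content K x"] all M show False by simp
  qed
  with D show ?thesis by (intro exI[of _ D]) (simp add: g_def)
qed

section \<open>Folding periodic residue counts\<close>

text \<open>
  The \<open>d\<close>-diagram \<open>E\<close> repeated \<open>q\<close> times, as the diagram of a shift-invariant multipartition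
  with \<open>d * q\<close> components.
\<close>

definition unfold :: "nat \<Rightarrow> nat \<Rightarrow> node set \<Rightarrow> node set" where
  "unfold d q E = {(a, b, c). c < d * q \<and> (a, b, c mod d) \<in> E}"

text \<open>
  This is compatibility of a multicharge, solved for all components in terms of the first \<open>d\<close>
  ones.
\<close>

definition unfolded_charge :: "nat \<Rightarrow> int \<Rightarrow> nat \<Rightarrow> (nat \<Rightarrow> int) \<Rightarrow> bool" where
  "unfolded_charge d h q K \<longleftrightarrow>
     (\<forall>c < d * q. [K c = K (c mod d) + int (c div d) * h] (mod (h * int q)))"

text \<open>
  The \<open>q\<close> copies of a node \<open>x\<close> of \<open>E\<close> have the residues \<open>content K x + j * h\<close> for
  \<open>j < q\<close>, which run once through the classes modulo \<open>h * q\<close> that lie over the class of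
  \<open>content K x\<close> modulo \<open>h\<close>.  So exactly one copy has a given residue over that class.
\<close>

lemma count_at_unfold:
  assumes "d > 0" "q > 0" "h > 0" "unfolded_charge d h q K" "E \<subseteq> UNIV \<times> UNIV \<times> {..<d}"
  shows "count_at (h * int q) K (unfold d q E) i = count_at h K E i"
proof (rule bij_betw_same_card)
  define \<phi> :: "node \<Rightarrow> node" where "\<phi> = (\<lambda>(a, b, c). (a, b, c mod d))"
  have K: "[K c = K (c mod d) + int (c div d) * h] (mod (h * int q))" if "c < d * q" for c
    using assms(4) that unfolding unfolded_charge_def by blast
  show "bij_betw \<phi> (nodes_at (h * int q) K (unfold d q E) i) (nodes_at h K E i)"
    unfolding bij_betw_def
  proof (intro conjI equalityI subsetI)
    show "inj_on \<phi> (nodes_at (h * int q) K (unfold d q E) i)"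
    proof (rule inj_onI)
      fix x y assume x: "x \<in> nodes_at (h * int q) K (unfold d q E) i"
        and y: "y \<in> nodes_at (h * int q) K (unfold d q E) i" and eq: "\<phi> x = \<phi> y"
      obtain a b c where xa: "x = (a, b, c)" by (cases x)
      obtain c' where ya: "y = (a, b, c')" and m: "c mod d = c' mod d"
        using eq xa by (cases y) (auto simp: \<phi>_def)
      have lt: "c < d * q" "c' < d * q"
        using x y xa ya by (auto simp: nodes_at_def unfold_def)
      have "[content K (a, b, c) = content K (a, b, c')] (mod (h * int q))"
        using x y xa ya by (auto simp: nodes_at_def cong_def)
      then have "[K c = K c'] (mod (h * int q))"
        by (simp add: cong_iff_dvd_diff algebra_simps)
      then have "[K (c mod d) + int (c div d) * h = K (c mod d) + int (c' div d) * h] (mod (h * int q))"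
        using K[OF lt(1)] K[OF lt(2)] m by (metis cong_sym cong_trans)
      then have "[int (c div d) * h = int (c' div d) * h] (mod (h * int q))"
        by (simp add: cong_add_lcancel)
      then have "[int (c div d) = int (c' div d)] (mod int q)"
        using \<open>h > 0\<close> by (simp add: cong_iff_dvd_diff flip: left_diff_distrib)
      moreover have "c div d < q" "c' div d < q"
        using lt by (auto simp: less_mult_imp_div_less mult.commute)
      ultimately have "c div d = c' div d"
        by (simp add: cong_def)
      with m have "c = c'" by (metis div_mult_mod_eq)
      then show "x = y" using xa ya by simp
    qed
  next
    fix y assume "y \<in> \<phi> ` nodes_at (h * int q) K (unfold d q E) i"
    then obtain a b c where y: "y = (a, b, c mod d)" and c: "c < d * q" "(a, b, c mod d) \<in> E"
      and cong: "[content K (a, b, c) = i] (mod (h * int q))"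
      by (auto simp: \<phi>_def nodes_at_def unfold_def)
    have "[K c = K (c mod d) + int (c div d) * h] (mod h)"
      using K[OF c(1)] by (rule cong_dvd_modulus) simp
    moreover have "[K (c mod d) + int (c div d) * h = K (c mod d)] (mod h)"
      by (simp add: cong_def)
    ultimately have "[K c = K (c mod d)] (mod h)" by (rule cong_trans)
    then have "[content K (a, b, c) = content K (a, b, c mod d)] (mod h)"
      by (simp add: cong_iff_dvd_diff)
    moreover have "[content K (a, b, c) = i] (mod h)"
      using cong by (rule cong_dvd_modulus) simp
    ultimately have "[content K (a, b, c mod d) = i] (mod h)"
      using cong_trans cong_sym by blast
    then show "y \<in> nodes_at h K E i"
      using c y by (simp add: nodes_at_def)
  next
    fix y assume y: "y \<in> nodes_at h K E i"
    obtain a b c where ya: "y = (a, b, c)" by (cases y)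
    have c: "c < d" "(a, b, c) \<in> E" and cong: "[content K (a, b, c) = i] (mod h)"
      using y ya assms(5) by (auto simp: nodes_at_def)
    \<comment> \<open>The copy of \<open>(a, b, c)\<close> with residue \<open>i\<close> is the one whose index \<open>j\<close> is congruent to \<open>m\<close>
      modulo \<open>q\<close>.\<close>
    obtain m where m: "i - content K (a, b, c) = h * m"
      using cong by (metis cong_iff_dvd_diff cong_sym dvdE)
    define j where "j = nat (m mod int q)"
    have j: "j < q" "int j = m mod int q"
      using \<open>q > 0\<close> by (simp_all add: j_def nat_less_iff)
    define c' where "c' = c + d * j"
    have "c' < d * Suc j" using c(1) by (simp add: c'_def)
    also have "\<dots> \<le> d * q" using j(1) by (intro mult_le_mono) auto
    finally have c'_lt: "c' < d * q" .
    have c': "c' mod d = c" "c' div d = j"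
      using c(1) \<open>d > 0\<close> by (simp_all add: c'_def)
    have "[int j * h = m * h] (mod (int q * h))"
      unfolding j(2) by (simp add: cong_def mod_mult_mult2)
    then have "[K c + int j * h = K c + m * h] (mod (h * int q))"
      by (simp add: mult.commute cong_add_lcancel)
    with K[OF c'_lt] have "[K c' = K c + m * h] (mod (h * int q))"
      unfolding c' by (rule cong_trans)
    moreover have "content K (a, b, c') - i = K c' - (K c + m * h)"
      using m by (simp add: algebra_simps)
    ultimately have "[content K (a, b, c') = i] (mod (h * int q))"
      by (simp only: cong_iff_dvd_diff)
    then have "(a, b, c') \<in> nodes_at (h * int q) K (unfold d q E) i"
      using c c' c'_lt by (simp add: nodes_at_def unfold_def)
    moreover have "\<phi> (a, b, c') = y" using c' ya by (simp add: \<phi>_def)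
    ultimately show "y \<in> \<phi> ` nodes_at (h * int q) K (unfold d q E) i" by force
  qed
qed

lemma unfold_corners: "d > 0 \<Longrightarrow> unfold d q (corners d) = corners (d * q)"
  by (auto simp: unfold_def corners_def)

text \<open>
  If \<open>f\<close> is dominant, a diagram exists by \<open>dominant_counts_realised\<close>.  Otherwise
  dominance fails at some \<open>i\<close>, by an amount \<open>n > 0\<close>.  Periodicity of \<open>f\<close> and of the charges makes it fail by the same
  amount at every residue modulo \<open>h * q\<close> above \<open>i\<close>, so \<open>D\<close> has at least \<open>n\<close> removable
  nodes of each of these residues.  Deleting \<open>n\<close> of each leaves a smaller diagram whose counts are
  again periodic, and induction gives a diagram \<open>E\<close> with \<open>d\<close> components for them.
  In terms of weights, the simple reflection at \<open>i\<close> has been applied, so \<open>E\<close> has at least \<open>n\<close>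
  addable \<open>i\<close>-nodes, and inserting \<open>n\<close> of them undoes the reflection.
\<close>

theorem folded_counts_realised:
  fixes f :: "int \<Rightarrow> nat" and h :: int
  assumes "d > 0" "q > 0" "h > 0" "unfolded_charge d h q K"
  shows "diagram (d * q) D \<Longrightarrow> (\<And>i. count_at (h * int q) K D i = f i) \<Longrightarrow> (\<And>i. f (i mod h) = f i) \<Longrightarrow>
    \<exists>E. diagram d E \<and> (\<forall>i. count_at h K E i = f i)"
proof (induction "card D" arbitrary: D f rule: less_induct)
  case less
  define e where "e = h * int q"
  have "e > 0" using assms by (simp add: e_def)
  have f_cong: "f i = f j" if "[i = j] (mod h)" for i j
    using less.prems(3)[of i] less.prems(3)[of j] that by (simp add: cong_def)
  have corners: "count_at e K (corners (d * q)) i = count_at h K (corners d) i" for i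
    using count_at_unfold[OF assms, of "corners d" i] unfold_corners[OF assms(1), of q]
    by (auto simp: e_def corners_def)
  note cD = less.prems(2)[folded e_def]
  show ?case
  proof (cases "\<forall>i. 2 * f i \<le> count_at h K (corners d) i + f (i - 1) + f (i + 1)")
    case True
    then show ?thesis
      using assms less.prems(3) by (intro dominant_counts_realised) auto
  next
    case False
    then obtain i where i: "count_at h K (corners d) i + f (i - 1) + f (i + 1) < 2 * f i"
      by (auto simp: not_le)
    define n where "n = 2 * f i - (count_at h K (corners d) i + f (i - 1) + f (i + 1))"
    have n: "n > 0" "2 * f i = count_at h K (corners d) i + f (i - 1) + f (i + 1) + n"
      using i by (auto simp: n_def)
    have rem: "n \<le> count_at e K (removable D) j" if "[j = i] (mod h)" for j
    proof -
      have "count_at h K (corners d) j = count_at h K (corners d) i"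
        using nodes_at_cong[OF that] by simp
      moreover have "f j = f i" "f (j - 1) = f (i - 1)" "f (j + 1) = f (i + 1)"
        using that by (auto intro!: f_cong cong_add cong_diff)
      ultimately show ?thesis
        using addable_removable_balance[OF less.prems(1), of e K j] n(2)
        by (simp add: cD corners)
    qed
    \<comment> \<open>The residues modulo \<open>e\<close> above \<open>i\<close>; the set \<open>S j\<close> consists of the nodes of residue \<open>j\<close> that
      are deleted.\<close>
    define J where "J = {j \<in> {0..<e}. [j = i] (mod h)}"
    have "\<forall>j. \<exists>T. j \<in> J \<longrightarrow> T \<subseteq> nodes_at e K (removable D) j \<and> card T = n"
      using rem obtain_subset_with_card_n by (metis (mono_tags, lifting) J_def mem_Collect_eq)
    then obtain S where S: "\<And>j. j \<in> J \<Longrightarrow> S j \<subseteq> nodes_at e K (removable D) j"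
        "\<And>j. j \<in> J \<Longrightarrow> card (S j) = n"
      by metis
    define T where "T = (\<Union>j\<in>J. S j)"
    have T_rem: "T \<subseteq> removable D"
      using S(1) by (auto simp: T_def nodes_at_def)
    have T_D: "T \<subseteq> D"
      using T_rem by (auto simp: removable_def)
    have finD: "finite D" using less.prems(1) by (rule diagram_finite)
    have cong_e_h: "[j = k] (mod h)" if "[j = k] (mod e)" for j k
      using that by (rule cong_dvd_modulus) (simp add: e_def)
    have T_count: "count_at e K T k = (if [k = i] (mod h) then n else 0)" for k
    proof -
      have "nodes_at e K T k = (if [k = i] (mod h) then S (k mod e) else {})"
      proof (intro equalityI subsetI)
        fix x assume "x \<in> nodes_at e K T k"
        then obtain j where j: "j \<in> J" "x \<in> S j" and k: "[content K x = k] (mod e)"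
          by (auto simp: nodes_at_def T_def)
        then have "[content K x = j] (mod e)"
          using S(1) by (auto simp: nodes_at_def)
        with k have jk: "[k = j] (mod e)" using cong_sym cong_trans by blast
        then have "k mod e = j" using j(1) by (simp add: J_def cong_def)
        moreover have "[k = i] (mod h)"
          using cong_e_h[OF jk] j(1) cong_trans by (auto simp: J_def)
        ultimately show "x \<in> (if [k = i] (mod h) then S (k mod e) else {})"
          using j by simp
      next
        fix x assume x: "x \<in> (if [k = i] (mod h) then S (k mod e) else {})"
        then have k: "[k = i] (mod h)" and x: "x \<in> S (k mod e)" by (auto split: if_splits)
        have "[k mod e = k] (mod h)" by (rule cong_e_h) simp
        then have J: "k mod e \<in> J"
          using k \<open>e > 0\<close> cong_trans by (auto simp: J_def)
        with x S(1) have "x \<in> nodes_at e K (removable D) (k mod e)" by blast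
        then show "x \<in> nodes_at e K T k"
          using J x by (auto simp: nodes_at_def T_def)
      qed
      moreover have "k mod e \<in> J" if "[k = i] (mod h)"
      proof -
        have "[k mod e = k] (mod h)" by (rule cong_e_h) simp
        then show ?thesis using that \<open>e > 0\<close> cong_trans by (auto simp: J_def)
      qed
      ultimately show ?thesis using S(2) by simp
    qed
    define f' where "f' k = f k - (if [k = i] (mod h) then n else 0)" for k
    have le: "(if [k = i] (mod h) then n else 0) \<le> f k" for k
      using count_at_diff[OF finD T_D, of e K k] by (simp add: T_count cD)
    have "\<exists>E. diagram d E \<and> (\<forall>i. count_at h K E i = f' i)"
    proof (rule less.hyps)
      have "T \<noteq> {}"
        using T_count[of i] n(1) by (auto simp: nodes_at_def)
      then show "card (D - T) < card D"
        using finD T_D by (intro psubset_card_mono) auto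
      show "diagram (d * q) (D - T)"
        using less.prems(1) T_rem by (rule diagram_diff_removable)
      show "count_at (h * int q) K (D - T) k = f' k" for k
        using count_at_diff[OF finD T_D, of e K k] unfolding T_count cD f'_def e_def[symmetric]
        by linarith
      show "f' (k mod h) = f' k" for k
        using less.prems(3)[of k] by (simp add: f'_def cong_def)
    qed
    then obtain E where E: "diagram d E" "\<And>k. count_at h K E k = f' k" by blast
    \<comment> \<open>For \<open>h = 1\<close> all neighbours of \<open>i\<close> coincide with \<open>i\<close>, and every vector is dominant.  For
      \<open>h > 1\<close> the reflection leaves the counts at \<open>i - 1\<close> and \<open>i + 1\<close> unchanged.\<close>
    have "h \<noteq> 1"
    proof
      assume "h = 1"
      then have "f (i - 1) = f i" "f (i + 1) = f i" by (auto intro: f_cong)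
      with i show False by simp
    qed
    then have "\<not> [i - 1 = i] (mod h)" "\<not> [i + 1 = i] (mod h)"
      using \<open>h > 0\<close> by (auto simp: cong_iff_dvd_diff)
    then have "f' (i - 1) = f (i - 1)" "f' (i + 1) = f (i + 1)" "f' i = f i - n" "n \<le> f i"
      using le[of i] by (auto simp: f'_def)
    then have "n \<le> count_at h K (addable d E) i"
      using addable_removable_balance[OF E(1), of h K i] n(2) by (simp add: E(2))
    then obtain A where A: "A \<subseteq> nodes_at h K (addable d E) i" "card A = n" "finite A"
      by (rule obtain_subset_with_card_n)
    have A_add: "A \<subseteq> addable d E" using A(1) by (auto simp: nodes_at_def)
    have "[content K x = k] (mod h) \<longleftrightarrow> [k = i] (mod h)" if "x \<in> A" for x k
      using A(1) that unfolding nodes_at_def by (auto simp: cong_def simp del: content.simps)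
    then have "nodes_at h K A k = (if [k = i] (mod h) then A else {})" for k
      by (auto simp: nodes_at_def simp del: content.simps)
    then have A_count: "count_at h K A k = (if [k = i] (mod h) then n else 0)" for k
      using A(2) by simp
    have "E \<inter> A = {}" using A_add by (auto simp: addable_def)
    then have "count_at h K (E \<union> A) k = f k" for k
      using E A(3) le[of k] by (subst count_at_union) (auto simp: diagram_finite A_count f'_def)
    moreover have "diagram d (E \<union> A)"
      using E(1) A_add by (rule diagram_union_addable)
    ultimately show ?thesis by blast
  qed
qed

section \<open>Multipartitions and their diagrams\<close>

lemma mem_multi_young_diagram:
  "(a, b, c) \<in> multi_young_diagram \<Lambda> \<longleftrightarrow> c < length \<Lambda> \<and> a < length (\<Lambda> ! c) \<and> b < \<Lambda> ! c ! a"
  by (auto simp: multi_young_diagram_def young_diagram_def)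

lemma diagram_multi_young_diagram:
  assumes "multipartition r \<Lambda>"
  shows "diagram r (multi_young_diagram \<Lambda>)"
proof -
  have len: "length \<Lambda> = r" using assms by (simp add: multipartition_def)
  have dec: "\<Lambda> ! c ! Suc a \<le> \<Lambda> ! c ! a" if "c < r" "Suc a < length (\<Lambda> ! c)" for a c
    using assms that by (auto simp: multipartition_def is_partition_def intro: sorted_wrt_nth_less)
  have "(a, b, c) \<in> multi_young_diagram \<Lambda>" if "(Suc a, b, c) \<in> multi_young_diagram \<Lambda>" for a b c
    using that dec[of c a] len by (auto simp: mem_multi_young_diagram)
  moreover have "(a, b, c) \<in> multi_young_diagram \<Lambda>" if "(a, Suc b, c) \<in> multi_young_diagram \<Lambda>" for a b c
    using that by (auto simp: mem_multi_young_diagram)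
  moreover have "multi_young_diagram \<Lambda> \<subseteq> UNIV \<times> UNIV \<times> {..<r}"
    using len by (auto simp: mem_multi_young_diagram)
  ultimately show ?thesis
    unfolding diagram_def using finite_multi_young_diagram by blast
qed

lemma finite_down_closed_eq_lessThan:
  assumes "finite S" "\<And>n. Suc n \<in> S \<Longrightarrow> n \<in> S"
  shows "S = {..<card S}"
proof -
  have down: "m \<in> S" if "n \<in> S" "m \<le> n" for m n
    using that(2,1) by (induction rule: inc_induct) (auto intro: assms(2))
  define k where "k = (LEAST n. n \<notin> S)"
  have "\<exists>n. n \<notin> S" using assms(1) by (metis UNIV_eq_I infinite_UNIV_nat)
  then have "k \<notin> S" unfolding k_def by (rule LeastI_ex)
  then have "S = {..<k}"
    using down not_less_Least[of _ "\<lambda>n. n \<notin> S"] unfolding k_def[symmetric]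
    by (auto simp: not_less) (meson not_less)
  then show ?thesis by simp
qed

text \<open>
  The row lengths of the partitions are read off from \<open>D\<close>: rows and first columns of a diagram are
  initial segments, hence determined by their cardinalities.
\<close>

lemma multipartition_of_diagram:
  assumes "diagram r D"
  obtains M where "multipartition r M" "multi_young_diagram M = D"
proof -
  have fin: "finite D" and lt: "\<And>a b c. (a, b, c) \<in> D \<Longrightarrow> c < r"
    and low1: "\<And>a b c. (Suc a, b, c) \<in> D \<Longrightarrow> (a, b, c) \<in> D"
    and low2: "\<And>a b c. (a, Suc b, c) \<in> D \<Longrightarrow> (a, b, c) \<in> D"
    using assms unfolding diagram_def by blast+
  define row where "row c a = card {b. (a, b, c) \<in> D}" for a c
  define rows where "rows c = card {a. (a, 0, c) \<in> D}" for c
  have "finite ((\<lambda>b. (a, b, c)) -` D)" "finite ((\<lambda>a. (a, 0, c)) -` D)" for a c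
    by (rule finite_vimageI[OF fin]; simp add: inj_def)+
  then have "{b. (a, b, c) \<in> D} = {..<row c a}" "{a. (a, 0, c) \<in> D} = {..<rows c}" for a c
    unfolding row_def rows_def
    by (intro finite_down_closed_eq_lessThan; auto simp: vimage_def intro: low1 low2)+
  then have row: "(a, b, c) \<in> D \<longleftrightarrow> b < row c a" and rows: "(a, 0, c) \<in> D \<longleftrightarrow> a < rows c" for a b c
    by blast+
  have low: "(i, b, c) \<in> D" if "i \<le> j" "(j, b, c) \<in> D" for i j b c
    using that by (induction rule: inc_induct) (auto intro: low1)
  have anti: "row c j \<le> row c i" if "i \<le> j" for i j c
    using low[OF that] unfolding row by (meson not_less order.irrefl)
  define M where "M = map (\<lambda>c. map (row c) [0..<rows c]) [0..<r]"
  have "is_partition (map (row c) [0..<rows c])" for c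
    unfolding is_partition_def
  proof
    show "sorted_wrt (\<ge>) (map (row c) [0..<rows c])"
      by (auto simp: sorted_wrt_iff_nth_less intro: anti)
    show "0 \<notin> set (map (row c) [0..<rows c])"
      using row[of _ 0 c] rows[of _ c] by auto
  qed
  then have "multipartition r M" by (auto simp: multipartition_def M_def)
  moreover have "multi_young_diagram M = D"
  proof -
    have "(a, b, c) \<in> multi_young_diagram M \<longleftrightarrow> (a, b, c) \<in> D" for a b c
    proof
      assume "(a, b, c) \<in> D"
      moreover from this have "(a, 0, c) \<in> D"
        unfolding row by simp
      ultimately have "c < r" "a < rows c" "b < row c a"
        using lt rows row by blast+
      then show "(a, b, c) \<in> multi_young_diagram M"
        by (simp add: mem_multi_young_diagram M_def)
    qed (auto simp: mem_multi_young_diagram M_def row)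
    then show ?thesis by auto
  qed
  ultimately show thesis by (rule that)
qed

text \<open>
  The condition \<open>i mod int e = i\<close> singles out the canonical representatives, outside of which
  \<open>alpha\<close> vanishes although \<open>count_at\<close> is periodic.
\<close>

lemma lookup_alpha:
  "Poly_Mapping.lookup (alpha e \<kappa> \<Lambda>) i =
    (if i mod int e = i then int (count_at (int e) ((!) \<kappa>) (multi_young_diagram \<Lambda>) i) else 0)"
proof -
  have res: "residue e \<kappa> x = content ((!) \<kappa>) x mod int e" for x
    by (cases x) simp
  have "Poly_Mapping.lookup (alpha e \<kappa> \<Lambda>) i
      = (\<Sum>x\<in>multi_young_diagram \<Lambda>. if residue e \<kappa> x = i then 1 else 0)"
    unfolding alpha_def lookup_sum by (intro sum.cong) auto
  also have "\<dots> = int (card {x \<in> multi_young_diagram \<Lambda>. residue e \<kappa> x = i})"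
    using finite_multi_young_diagram[of \<Lambda>] by (simp add: sum.If_cases Int_def)
  also have "{x \<in> multi_young_diagram \<Lambda>. residue e \<kappa> x = i} =
      (if i mod int e = i then nodes_at (int e) ((!) \<kappa>) (multi_young_diagram \<Lambda>) i else {})"
    unfolding nodes_at_def res by (auto simp: cong_def)
  finally show ?thesis by simp
qed

lemma alpha_eq_iff:
  "alpha e \<kappa> \<Lambda> = alpha e \<kappa> M \<longleftrightarrow>
    (\<forall>i. count_at (int e) ((!) \<kappa>) (multi_young_diagram \<Lambda>) i =
         count_at (int e) ((!) \<kappa>) (multi_young_diagram M) i)"
proof
  assume eq: "alpha e \<kappa> \<Lambda> = alpha e \<kappa> M"
  show "\<forall>i. count_at (int e) ((!) \<kappa>) (multi_young_diagram \<Lambda>) i =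
         count_at (int e) ((!) \<kappa>) (multi_young_diagram M) i"
  proof
    fix i
    show "count_at (int e) ((!) \<kappa>) (multi_young_diagram \<Lambda>) i =
         count_at (int e) ((!) \<kappa>) (multi_young_diagram M) i"
      using arg_cong[OF eq, of "\<lambda>x. Poly_Mapping.lookup x (i mod int e)"]
      by (simp add: lookup_alpha)
  qed
next
  assume "\<forall>i. count_at (int e) ((!) \<kappa>) (multi_young_diagram \<Lambda>) i =
         count_at (int e) ((!) \<kappa>) (multi_young_diagram M) i"
  then show "alpha e \<kappa> \<Lambda> = alpha e \<kappa> M"
    by (intro poly_mapping_eqI) (simp add: lookup_alpha)
qed

section \<open>Shifts and orbits\<close>

lemma periodic_mod_eq:
  fixes h :: int
  assumes "\<And>i. f (i + h) = f i"
  shows "f (i mod h) = f i"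
proof -
  have mult: "f (i + int m * h) = f i" for i m
  proof (induction m)
    case (Suc m)
    then show ?case using assms[of "i + int m * h"] by (simp add: algebra_simps)
  qed simp
  show ?thesis
  proof (cases "i div h \<ge> 0")
    case True
    then show ?thesis using mult[of "i mod h" "nat (i div h)"] by simp
  next
    case False
    then show ?thesis
      using mult[of i "nat (- (i div h))"] by (simp add: minus_div_mult_eq_mod)
  qed
qed

lemma shift_mp_eq_rotate:
  assumes "length \<Lambda> = d * p" "d \<ge> 1" "p \<ge> 1"
  shows "shift_mp d \<Lambda> = rotate (d * (p - 1)) \<Lambda>"
proof -
  have "d * p - d = d * (p - 1)" by (simp add: diff_mult_distrib2)
  moreover have "d * (p - 1) < length \<Lambda>" using assms by simp
  ultimately show ?thesis using assms(1) by (simp add: shift_mp_def rotate_drop_take)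
qed

lemma shift_mp_funpow_rotate:
  assumes "length \<Lambda> = d * p" "d \<ge> 1" "p \<ge> 1"
  shows "(shift_mp d ^^ n) \<Lambda> = rotate (n * (d * (p - 1))) \<Lambda>"
proof (induction n)
  case (Suc n)
  then show ?case
    using shift_mp_eq_rotate[of "rotate (n * (d * (p - 1))) \<Lambda>" d p] assms
    by (simp add: rotate_rotate)
qed simp

lemma multi_young_diagram_shift_mp:
  assumes "length \<Lambda> = d * p" "d \<ge> 1" "p \<ge> 1"
  shows "bij_betw (\<lambda>(a, b, c). (a, b, (c + d) mod (d * p)))
    (multi_young_diagram \<Lambda>) (multi_young_diagram (shift_mp d \<Lambda>))"
proof (rule bij_betw_byWitness[where f' = "\<lambda>(a, b, c). (a, b, (d * (p - 1) + c) mod (d * p))"])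
  have r: "d * (p - 1) + d = d * p"
    using assms(3) by (cases p) auto
  have inv1: "(d * (p - 1) + (c + d) mod (d * p)) mod (d * p) = c" if "c < d * p" for c
  proof -
    have "(d * (p - 1) + (c + d) mod (d * p)) mod (d * p) = (c + (d * (p - 1) + d)) mod (d * p)"
      by (simp add: mod_simps ac_simps)
    with that show ?thesis unfolding r by simp
  qed
  have inv2: "((d * (p - 1) + c) mod (d * p) + d) mod (d * p) = c" if "c < d * p" for c
  proof -
    have "((d * (p - 1) + c) mod (d * p) + d) mod (d * p) = (c + (d * (p - 1) + d)) mod (d * p)"
      by (simp add: mod_simps ac_simps)
    with that show ?thesis unfolding r by simp
  qed
  have nth: "shift_mp d \<Lambda> ! c = \<Lambda> ! ((d * (p - 1) + c) mod (d * p))" if "c < d * p" for c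
    using that assms by (simp add: shift_mp_eq_rotate nth_rotate)
  have len: "length (shift_mp d \<Lambda>) = d * p"
    using assms by (simp add: shift_mp_eq_rotate)
  have pos: "0 < d * p" using assms by simp
  show "\<forall>x\<in>multi_young_diagram \<Lambda>. (case case x of (a, b, c) \<Rightarrow> (a, b, (c + d) mod (d * p)) of
      (a, b, c) \<Rightarrow> (a, b, (d * (p - 1) + c) mod (d * p))) = x"
    using assms(1) by (auto simp: mem_multi_young_diagram inv1 simp del: One_nat_def)
  show "\<forall>x\<in>multi_young_diagram (shift_mp d \<Lambda>). (case case x of (a, b, c) \<Rightarrow> (a, b, (d * (p - 1) + c) mod (d * p)) of
      (a, b, c) \<Rightarrow> (a, b, (c + d) mod (d * p))) = x"
    using len by (auto simp: mem_multi_young_diagram inv2 simp del: One_nat_def)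
  show "(\<lambda>(a, b, c). (a, b, (c + d) mod (d * p))) ` multi_young_diagram \<Lambda> \<subseteq> multi_young_diagram (shift_mp d \<Lambda>)"
    using assms(1) pos by (auto simp: mem_multi_young_diagram len nth inv1 simp del: nat_0_less_mult_iff One_nat_def)
  show "(\<lambda>(a, b, c). (a, b, (d * (p - 1) + c) mod (d * p))) ` multi_young_diagram (shift_mp d \<Lambda>)
      \<subseteq> multi_young_diagram \<Lambda>"
    using assms(1) pos by (auto simp: mem_multi_young_diagram len nth simp del: nat_0_less_mult_iff One_nat_def)
qed

text \<open>
  Moving a node \<open>d\<close> components further adds \<open>\<eta>\<close> to its residue, by compatibility of the
  multicharge, so the two shifts correspond to each other.
\<close>

lemma alpha_shift_mp:
  assumes "length \<Lambda> = d * p" "d \<ge> 1" "p \<ge> 1" "compatible d \<eta> p \<kappa>"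
  shows "alpha (\<eta> * p) \<kappa> (shift_mp d \<Lambda>) = shift_Q (\<eta> * p) \<eta> (alpha (\<eta> * p) \<kappa> \<Lambda>)"
proof -
  have res: "residue (\<eta> * p) \<kappa> (a, b, (c + d) mod (d * p))
      = (residue (\<eta> * p) \<kappa> (a, b, c) + int \<eta>) mod int (\<eta> * p)" if "c < d * p" for a b c
  proof -
    have "\<kappa> ! ((c + d) mod (d * p)) = (\<kappa> ! c + int \<eta>) mod int (\<eta> * p)"
      using assms(4) that by (simp add: compatible_def)
    then show ?thesis by (simp add: mod_simps add.assoc del: of_nat_mult)
  qed
  show ?thesis
    unfolding alpha_def shift_Q_def frag_extend_sum[OF finite_multi_young_diagram] o_def frag_extend_of
  proof (rule sum.reindex_bij_betw[OF multi_young_diagram_shift_mp[OF assms(1-3)], symmetric, THEN trans],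
      rule sum.cong[OF refl])
    fix x assume "x \<in> multi_young_diagram \<Lambda>"
    then show "frag_of (residue (\<eta> * p) \<kappa> (case x of (a, b, c) \<Rightarrow> (a, b, (c + d) mod (d * p)))) =
        frag_of ((residue (\<eta> * p) \<kappa> x + int \<eta>) mod int (\<eta> * p))"
      using assms(1) res by (cases x) (auto simp: mem_multi_young_diagram simp del: residue.simps)
  qed
qed

lemma alpha_shift_mp_funpow:
  assumes "length \<Lambda> = d * p" "d \<ge> 1" "p \<ge> 1" "compatible d \<eta> p \<kappa>"
  shows "alpha (\<eta> * p) \<kappa> ((shift_mp d ^^ n) \<Lambda>) = (shift_Q (\<eta> * p) \<eta> ^^ n) (alpha (\<eta> * p) \<kappa> \<Lambda>)"
proof (induction n)
  case (Suc n)
  have "length ((shift_mp d ^^ n) \<Lambda>) = d * p"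
    using assms by (simp add: shift_mp_funpow_rotate)
  then show ?case using Suc alpha_shift_mp assms by simp
qed simp

lemma lookup_shift_Q:
  assumes "Poly_Mapping.keys x \<subseteq> {0..<int e}"
  shows "Poly_Mapping.lookup (shift_Q e \<eta> x) ((i + int \<eta>) mod int e) = Poly_Mapping.lookup x (i mod int e)"
proof -
  have "Poly_Mapping.lookup (shift_Q e \<eta> x) ((i + int \<eta>) mod int e) =
     (\<Sum>j\<in>Poly_Mapping.keys x. Poly_Mapping.lookup x j *
        (if (i + int \<eta>) mod int e = (j + int \<eta>) mod int e then 1 else 0))"
    unfolding shift_Q_def frag_extend_def by (simp add: lookup_sum)
  also have "\<dots> = (\<Sum>j\<in>Poly_Mapping.keys x. if j = i mod int e then Poly_Mapping.lookup x j else 0)"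
  proof (intro sum.cong refl)
    fix j assume "j \<in> Poly_Mapping.keys x"
    then have "j mod int e = j" using assms by auto
    then have "(i + int \<eta>) mod int e = (j + int \<eta>) mod int e \<longleftrightarrow> j = i mod int e"
      using cong_add_rcancel[of i "int \<eta>" j "int e"] by (auto simp: cong_def)
    then show "Poly_Mapping.lookup x j * (if (i + int \<eta>) mod int e = (j + int \<eta>) mod int e then 1 else 0)
        = (if j = i mod int e then Poly_Mapping.lookup x j else 0)" by simp
  qed
  also have "\<dots> = Poly_Mapping.lookup x (i mod int e)"
    by (simp add: in_keys_iff)
  finally show ?thesis .
qed

lemma card_orbit_le:
  assumes "(f ^^ t) x = x" "t > 0"
  shows "card (orbit f x) \<le> t"
proof -
  have "orbit f x \<subseteq> (\<lambda>n. (f ^^ n) x) ` {..<t}"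
  proof
    fix y assume "y \<in> orbit f x"
    then obtain n where "y = (f ^^ n) x" by (auto simp: orbit_altdef)
    also have "\<dots> = (f ^^ (n mod t)) x" using assms(1) by (simp add: funpow_mod_eq)
    finally show "y \<in> (\<lambda>n. (f ^^ n) x) ` {..<t}" using assms(2) by auto
  qed
  then have "card (orbit f x) \<le> card ((\<lambda>n. (f ^^ n) x) ` {..<t})"
    by (rule card_mono[rotated]) simp
  also have "\<dots> \<le> t" using card_image_le[of "{..<t}"] by simp
  finally show ?thesis .
qed

text \<open>
  Since \<open>x\<close> lies on its own orbit, the iterates before the first return are distinct and exhaust
  the orbit.
\<close>

lemma card_orbit_is_period:
  assumes "(f ^^ p) x = x" "p > 0"
  shows "(f ^^ card (orbit f x)) x = x" "card (orbit f x) dvd p" "card (orbit f x) > 0"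
proof -
  have self: "x \<in> orbit f x"
    unfolding orbit_altdef using assms by (intro CollectI exI[of _ p]) simp
  define t where "t = funpow_dist1 f x x"
  have inj: "inj_on (\<lambda>n. (f ^^ n) x) {0..<t}"
    unfolding t_def using self by (rule inj_on_funpow_dist1)
  have card: "card (orbit f x) = t"
    unfolding orbit_conv_funpow_dist1[OF self] t_def[symmetric] card_image[OF inj] by simp
  have t: "t > 0" "(f ^^ t) x = x"
    using funpow_dist1_prop[OF self] by (simp_all add: t_def)
  have "(f ^^ (p mod t)) x = (f ^^ 0) x"
    using assms(1) t(2) by (simp add: funpow_mod_eq)
  then have "p mod t = 0"
    using inj_onD[OF inj, of "p mod t" 0] t(1) by simp
  then show "(f ^^ card (orbit f x)) x = x" "card (orbit f x) dvd p" "card (orbit f x) > 0"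
    using t by (auto simp: card)
qed

lemma unfolded_charge_compatible:
  assumes "compatible d \<eta> (t * q) \<kappa>" "t > 0" "d > 0"
  shows "unfolded_charge (d * t) (int (\<eta> * t)) q ((!) \<kappa>)"
  unfolding unfolded_charge_def
proof (intro allI impI)
  fix c assume c: "c < d * t * q"
  have step: "[\<kappa> ! (k + d * j) = \<kappa> ! k + int (j * \<eta>)] (mod int (\<eta> * (t * q)))"
    if "k + d * j < d * (t * q)" for k j
    using that
  proof (induction j)
    case (Suc j)
    then have "\<kappa> ! (k + d * Suc j) = (\<kappa> ! (k + d * j) + int \<eta>) mod int (\<eta> * (t * q))"
      using assms(1)[unfolded compatible_def, rule_format, of "k + d * j"]
      by (simp add: ac_simps del: of_nat_mult)
    then have "[\<kappa> ! (k + d * Suc j) = \<kappa> ! (k + d * j) + int \<eta>] (mod int (\<eta> * (t * q)))"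
      by (simp add: cong_def del: of_nat_mult)
    also have "[\<kappa> ! (k + d * j) + int \<eta> = \<kappa> ! k + int (j * \<eta>) + int \<eta>] (mod int (\<eta> * (t * q)))"
      using Suc by (intro cong_add) auto
    finally show ?case by (simp add: algebra_simps)
  qed simp
  have "c mod (d * t) + d * (t * (c div (d * t))) = c"
    by (simp flip: mult.assoc)
  with step[of "c mod (d * t)" "t * (c div (d * t))"] c
  show "[\<kappa> ! c = \<kappa> ! (c mod (d * t)) + int (c div (d * t)) * int (\<eta> * t)] (mod (int (\<eta> * t) * int q))"
    by (simp add: ac_simps)
qed

section \<open>Multipartitions with the smallest possible orbit\<close>

theorem theorem1p3:
  fixes d \<eta> p e r :: nat and \<kappa> :: "int list" and \<Lambda> :: "nat list list"
    and \<alpha> :: "int \<Rightarrow>\<^sub>0 int"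
  assumes "d \<ge> 1" and "\<eta> \<ge> 1" and "p \<ge> 1"
    and "e = \<eta> * p" and "e \<ge> 2" and "r = d * p"
    and "multicharge e r \<kappa>"
    and "compatible d \<eta> p \<kappa>"
    and "multipartition r \<Lambda>"
    and "\<alpha> = alpha e \<kappa> \<Lambda>"
  shows "\<exists>M. multipartition r M \<and> alpha e \<kappa> M = \<alpha> \<and>
           card (orbit (shift_mp d) M) = card (orbit (shift_Q e \<eta>) \<alpha>)"
proof -
  \<comment> \<open>The orbit size \<open>t\<close> is the period of \<open>\<alpha>\<close>: it divides \<open>p\<close>, and \<open>\<alpha>\<close> is invariant under
    translation of residues by \<open>\<eta> * t\<close>.  The \<open>r\<close> components form \<open>q\<close> blocks of length \<open>d * t\<close>.\<close>
  define t where "t = card (orbit (shift_Q e \<eta>) \<alpha>)"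
  define K where "K = (!) \<kappa>"
  have e: "e > 0" using assms(5) by simp
  have keys: "Poly_Mapping.keys \<alpha> \<subseteq> {0..<int (\<eta> * p)}"
    using keys_alpha[OF e] assms(4,10) by simp
  have t: "(shift_Q e \<eta> ^^ t) \<alpha> = \<alpha>" "t dvd p" "t > 0"
    unfolding t_def using card_orbit_is_period[OF shift_Q_funpow[OF keys]] assms(3,4) by auto
  obtain q where q: "p = t * q" using t(2) by (elim dvdE)
  have "q > 0" using q assms(3) by (cases q) auto
  have e_eq: "int e = int (\<eta> * t) * int q" by (simp add: assms(4) q)
  have len: "length \<Lambda> = d * p" using assms(6,9) by (simp add: multipartition_def)
  define f where "f = count_at (int e) K (multi_young_diagram \<Lambda>)"
  have f_lookup: "int (f i) = Poly_Mapping.lookup \<alpha> (i mod int e)" for i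
    by (simp add: f_def K_def assms(10) lookup_alpha)
  have shifted: "Poly_Mapping.lookup ((shift_Q e \<eta> ^^ n) \<alpha>) ((i + int (n * \<eta>)) mod int e)
      = Poly_Mapping.lookup \<alpha> (i mod int e)" for n i
  proof (induction n)
    case (Suc n)
    have "(shift_Q e \<eta> ^^ n) \<alpha> = alpha e \<kappa> ((shift_mp d ^^ n) \<Lambda>)"
      using alpha_shift_mp_funpow[OF len assms(1,3,8)] assms(4,10) by simp
    then have "Poly_Mapping.keys ((shift_Q e \<eta> ^^ n) \<alpha>) \<subseteq> {0..<int e}"
      using keys_alpha[OF e] by simp
    from lookup_shift_Q[OF this, of \<eta> "i + int (n * \<eta>)"] Suc show ?case
      by (simp add: ac_simps)
  qed simp
  have f_step: "f (i + int (\<eta> * t)) = f i" for i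
    using shifted[of t i] unfolding t(1) f_lookup[symmetric] by (simp add: ac_simps)
  have f_per: "f (i mod int (\<eta> * t)) = f i" for i
    using f_step by (rule periodic_mod_eq)
  have charge: "unfolded_charge (d * t) (int (\<eta> * t)) q K"
    unfolding K_def using assms(1,8) t(3) unfolding q by (intro unfolded_charge_compatible) auto
  have "\<exists>E. diagram (d * t) E \<and> (\<forall>i. count_at (int (\<eta> * t)) K E i = f i)"
  proof (rule folded_counts_realised[OF _ \<open>q > 0\<close> _ charge])
    show "diagram (d * t * q) (multi_young_diagram \<Lambda>)"
      using diagram_multi_young_diagram[OF assms(9)] by (simp add: assms(6) q ac_simps)
    show "count_at (int (\<eta> * t) * int q) K (multi_young_diagram \<Lambda>) i = f i" for i
      unfolding e_eq[symmetric] by (simp add: f_def)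
  qed (use f_per assms(1,2) t(3) in auto)
  then obtain E where E: "diagram (d * t) E" "\<And>i. count_at (int (\<eta> * t)) K E i = f i" by blast
  then obtain L where L: "multipartition (d * t) L" "multi_young_diagram L = E"
    using multipartition_of_diagram by blast
  \<comment> \<open>Repeating \<open>L\<close> gives an \<open>r\<close>-partition invariant under \<open>t\<close> shifts.\<close>
  define M where "M = map (\<lambda>c. L ! (c mod (d * t))) [0..<r]"
  have dt: "d * t > 0" using assms(1) t(3) by simp
  have r_eq: "r = d * t * q" by (simp add: assms(6) q)
  have lenL: "length L = d * t" using L(1) by (simp add: multipartition_def)
  have M: "multipartition r M"
    using L(1) dt by (auto simp: multipartition_def M_def simp del: nat_0_less_mult_iff)
  have "multi_young_diagram M = unfold (d * t) q E"
    using dt lenL by (auto simp: mem_multi_young_diagram M_def unfold_def r_eq L(2)[symmetric]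
        simp del: nat_0_less_mult_iff)
  then have "count_at (int e) K (multi_young_diagram M) i = f i" for i
    using count_at_unfold[OF dt \<open>q > 0\<close> _ charge, of E i] E assms(2) t(3)
    by (simp add: e_eq[symmetric] diagram_def del: of_nat_mult)
  then have alpha_M: "alpha e \<kappa> M = \<alpha>"
    unfolding assms(10) alpha_eq_iff by (simp add: f_def K_def)
  have lenM: "length M = d * p" by (simp add: M_def assms(6))
  have "(shift_mp d ^^ t) M = M"
  proof (rule nth_equalityI)
    fix c assume "c < length ((shift_mp d ^^ t) M)"
    then have c: "c < r" using lenM assms(1,3,6) by (simp add: shift_mp_funpow_rotate)
    then have "(shift_mp d ^^ t) M ! c = M ! ((t * (d * (p - 1)) + c) mod r)"
      using lenM assms(1,3,6) by (simp add: shift_mp_funpow_rotate nth_rotate)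
    also have "\<dots> = L ! ((t * (d * (p - 1)) + c) mod r mod (d * t))"
      using c by (simp add: M_def)
    also have "(t * (d * (p - 1)) + c) mod r mod (d * t) = ((p - 1) * (d * t) + c) mod (d * t)"
      unfolding r_eq by (simp add: mod_mod_cancel ac_simps)
    also have "L ! (((p - 1) * (d * t) + c) mod (d * t)) = M ! c"
      using c by (simp add: M_def)
    finally show "(shift_mp d ^^ t) M ! c = M ! c" .
  qed (use lenM assms(1,3) in \<open>simp add: shift_mp_funpow_rotate\<close>)
  then have upper: "card (orbit (shift_mp d) M) \<le> t"
    using t(3) by (rule card_orbit_le)
  \<comment> \<open>Conversely, \<open>alpha\<close> maps the orbit of \<open>M\<close> onto that of \<open>\<alpha>\<close>.\<close>
  have "orbit (shift_Q e \<eta>) \<alpha> = alpha e \<kappa> ` orbit (shift_mp d) M"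
    unfolding orbit_altdef using alpha_shift_mp_funpow[OF lenM assms(1,3,8)] alpha_M assms(4)
    by (auto simp: image_iff) metis
  moreover have "finite (orbit (shift_mp d) M)"
    using self_in_orbit_shift_mp[OF lenM assms(3)] by (rule finite_orbit)
  ultimately have "t \<le> card (orbit (shift_mp d) M)"
    unfolding t_def by (simp add: card_image_le)
  with upper M alpha_M show ?thesis unfolding t_def by (intro exI[of _ M]) auto
qed

end
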